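(* Let $\tau=\frac{1+\sqrt5}{2}$. The logarithm of the growth rate of the size of the set of inflated random Fibonacci words equals the topological entropy of the random Fibonacci chain; that is, for $C\in\{A,B\}$, $$\lim_{n\to\infty}\frac{\log|A_n|}{f_{2n}}=\lim_{n\to\infty}\frac{\log|B_n|}{f_{2n-1}}=\lim_{n\to\infty}\frac{\log|F(C,n)|}{n}=\frac{1}{\tau^3}\log 2 .$$
   Context: Words are over the alphabet $\Sigma=\{\mathtt a,\mathtt b\}$. For a (finite or right-infinite) word $w=w_1w_2\ldots$ write $w[i,j]=w_iw_{i+1}\cdots w_j$, and for a set $W$ of words $W[i,j]=\{w[i,j]:w\in W\}$. For sets of words $U,V$, $UV=\{uv:u\in U,\,v\in V\}$ (concatenation). $|\cdot|$ denotes length of a word or cardinality of a set. Fibonacci numbers: $f_0=0$, $f_1=1$, $f_{n+1}=f_n+f_{n-1}$. Define $A_1=\{\mathtt a\}$, $B_1=\{\mathtt b\}$ and for $n\ge2$: $A_n=B_{n-1}A_{n-1}A_{n-1}$, $B_n=A_{n-1}B_{n-1}\cup B_{n-1}A_{n-1}$. (These are the sets of inflated words in generation $n$, i.e. the words obtainable from $\mathtt a$, resp. $\mathtt b$, by applying $n-1$ times the random substitution $\mathtt a\mapsto\mathtt{baa}$, $\mathtt b\mapsto\mathtt{ab}$ or $\mathtt{ba}$, the choice being made independently at each occurrence of $\mathtt b$.) All words in $A_n$ have length $f_{2n}$ and all words in $B_n$ have length $f_{2n-1}$. $A:=\lim_{n\to\infty}A_n$ and $B:=\lim_{n\to\infty}B_n$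 are limits in the sense of stabilising prefix sets: for $n\ge3$ one has $A_n[1,f_{2n-2}-1]=A_{n+1}[1,f_{2n-2}-1]$ and $B_n=B_{n+1}[1,f_{2n-1}]$; $A$ is the set of right-infinite words $w$ with $w[1,f_{2n-2}-1]\in A_n[1,f_{2n-2}-1]$ for all $n\ge3$, and $B$ is the set of right-infinite words $w$ with $w[1,f_{2n-1}]\in B_n$ for all $n\ge3$. For a set $S$ of words, $F(S,m)$ is the set of all sub-words (contiguous factors) of length $m$ of words in $S$. The (combinatorial, equivalently topological) entropy of the random Fibonacci chain is $\lim_{n\to\infty}\frac1n\log|F(A,n)|$. *)

theory Defs
  imports "HOL-Analysis.Analysis" "HOL-Number_Theory.Fib" "HOL-Library.Stream"
begin

datatype letter = LA | LB

definition conc :: "'a list set \<Rightarrow> 'a list set \<Rightarrow> 'a list set" (infixr "\<cdot>" 75) where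
  "U \<cdot> V = {u @ v | u v. u \<in> U \<and> v \<in> V}"

text \<open>
  The sets of inflated words \<open>A\<^sub>n\<close> and \<open>B\<^sub>n\<close>.
  Generations are counted from 1; the value at 0 is a placeholder.
\<close>

fun inflA :: "nat \<Rightarrow> letter list set" and inflB :: "nat \<Rightarrow> letter list set" where
  "inflA 0 = {}"
| "inflA (Suc 0) = {[LA]}"
| "inflA (Suc (Suc n)) = inflB (Suc n) \<cdot> inflA (Suc n) \<cdot> inflA (Suc n)"
| "inflB 0 = {}"
| "inflB (Suc 0) = {[LB]}"
| "inflB (Suc (Suc n)) = inflA (Suc n) \<cdot> inflB (Suc n) \<union> inflB (Suc n) \<cdot> inflA (Suc n)"

text \<open>
  The limit sets \<open>A\<close> and \<open>B\<close> of right-infinite words. Infinite words are streams,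
  so the prefix \<open>w[1,m]\<close> is \<open>stake m w\<close> (and \<open>take m u\<close> for a finite word \<open>u\<close>).
\<close>

definition limA :: "letter stream set" where
  "limA = {w. \<forall>n\<ge>3. stake (fib (2 * n - 2) - 1) w \<in> take (fib (2 * n - 2) - 1) ` inflA n}"

definition limB :: "letter stream set" where
  "limB = {w. \<forall>n\<ge>3. stake (fib (2 * n - 1)) w \<in> inflB n}"

definition factors :: "'a stream set \<Rightarrow> nat \<Rightarrow> 'a list set" where
  "factors S m = {stake m (sdrop i w) | i w. w \<in> S}"

definition tau :: real where
  "tau = (1 + sqrt 5) / 2"

end

theory Submission
  imports Defs "HOL-Library.Sublist"
begin

text \<open>
  Write \<open>h = ln 2 / \<tau>\<^sup>3\<close>. The proof has two halves: an exact count of the inflated words, and a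
  comparison of that count with the number of factors of the infinite words.

  The two branches \<open>A\<^sub>nB\<^sub>n\<close> and \<open>B\<^sub>nA\<^sub>n\<close> of \<open>B\<^sub>n\<^sub>+\<^sub>1\<close> are disjoint (\<open>inflB_branches_disjoint\<close>). All words
  of one set have the same length, so products of word sets multiply cardinalities, and the
  base-2 logarithms of \<open>|A\<^sub>n|\<close> and \<open>|B\<^sub>n|\<close> satisfy a linear recursion that Fibonacci numbers solve
  (\<open>card_infl\<close>): they are \<open>f\<^sub>2\<^sub>n\<^sub>-\<^sub>3 - 1\<close> and \<open>f\<^sub>2\<^sub>n\<^sub>-\<^sub>4 + 1\<close> for \<open>n \<ge> 2\<close>. Dividing by the word lengths \<open>f\<^sub>2\<^sub>n\<close> and
  \<open>f\<^sub>2\<^sub>n\<^sub>-\<^sub>1\<close>, whose indices are larger by three, gives \<open>1 / \<tau>\<^sup>3\<close> in the limit.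

  For the factors it suffices to bound the number of factors of \<open>B\<close> from below and that of \<open>A\<close> from
  above, since \<open>B \<subseteq> A\<close> (\<open>limB_subset_limA\<close>).

  Lower bound (\<open>ln_card_factors_ge\<close>): every word of \<open>B\<^sub>n\<close> is a prefix of a word in \<open>B\<close>. The number
  \<open>F(m)\<close> of factors of length \<open>m\<close> is submultiplicative, so \<open>|B\<^sub>n|\<close> is at most about
  \<open>F(m)\<close> to the power \<open>f\<^sub>2\<^sub>n\<^sub>-\<^sub>1 / m\<close>; letting \<open>n\<close> grow gives \<open>ln F(m) \<ge> h m\<close> for every fixed \<open>m > 0\<close>.

  Upper bound (\<open>card_factors_le\<close>): for each \<open>n\<close>, every prefix of a word in \<open>A\<close> is a prefix of a
  concatenation of blocks from \<open>L = A\<^sub>n \<union> B\<^sub>n\<close>. By a Kraft-type argument the number of such prefixes of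
  length \<open>m\<close> is \<open>O(\<rho>\<^sup>m)\<close> as soon as the sum of \<open>\<rho>\<close> to the power \<open>-|b|\<close> over the blocks \<open>b\<close> is at
  most 1. For \<open>\<rho> = exp (h + \<epsilon>)\<close> this sum tends to 0 as \<open>n\<close> grows, because \<open>|A\<^sub>n|\<close> and \<open>|B\<^sub>n|\<close> grow
  only like \<open>exp h\<close> to the power of the word length. So \<open>F(m) = O(exp (h + \<epsilon>)\<^sup>m)\<close> for every
  \<open>\<epsilon> > 0\<close>.
\<close>

section \<open>Products of word sets\<close>

lemma concE:
  assumes "w \<in> U \<cdot> V"
  obtains u v where "w = u @ v" "u \<in> U" "v \<in> V"
  using assms unfolding conc_def by blast

lemma concI: "u \<in> U \<Longrightarrow> v \<in> V \<Longrightarrow> u @ v \<in> U \<cdot> V"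
  unfolding conc_def by blast

lemma conc_eq_image: "U \<cdot> V = (\<lambda>(u, v). u @ v) ` (U \<times> V)"
  unfolding conc_def by auto

lemma conc_eq_empty_iff: "U \<cdot> V = {} \<longleftrightarrow> U = {} \<or> V = {}"
  by (auto simp: conc_eq_image)

lemma finite_conc: "finite U \<Longrightarrow> finite V \<Longrightarrow> finite (U \<cdot> V)"
  by (simp add: conc_eq_image)

lemma card_conc_le: "finite U \<Longrightarrow> finite V \<Longrightarrow> card (U \<cdot> V) \<le> card U * card V"
  unfolding conc_eq_image card_cartesian_product[symmetric] by (rule card_image_le) simp

lemma card_conc:
  assumes "\<And>u. u \<in> U \<Longrightarrow> length u = k"
  shows "card (U \<cdot> V) = card U * card V"
proof -
  have "inj_on (\<lambda>(u, v). u @ v) (U \<times> V)"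
    by (rule inj_onI) (auto simp: assms)
  then show ?thesis
    by (simp add: conc_eq_image card_image card_cartesian_product)
qed

section \<open>The number of inflated words\<close>

lemma inflA_Suc: "n \<ge> 1 \<Longrightarrow> inflA (Suc n) = inflB n \<cdot> inflA n \<cdot> inflA n"
  by (cases n) auto

lemma inflB_Suc: "n \<ge> 1 \<Longrightarrow> inflB (Suc n) = inflA n \<cdot> inflB n \<union> inflB n \<cdot> inflA n"
  by (cases n) auto

lemma inflA_SucE:
  assumes "w \<in> inflA (Suc n)" "n \<ge> 1"
  obtains x y z where "w = x @ y @ z" "x \<in> inflB n" "y \<in> inflA n" "z \<in> inflA n"
  using assms by (metis concE inflA_Suc)

lemma inflA_SucI:
  "n \<ge> 1 \<Longrightarrow> x \<in> inflB n \<Longrightarrow> y \<in> inflA n \<Longrightarrow> z \<in> inflA n \<Longrightarrow> x @ y @ z \<in> inflA (Suc n)"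
  by (simp add: inflA_Suc concI)

lemma inflB_SucE:
  assumes "w \<in> inflB (Suc n)" "n \<ge> 1"
  obtains x y where "w = x @ y" "x \<in> inflA n" "y \<in> inflB n"
    | x y where "w = x @ y" "x \<in> inflB n" "y \<in> inflA n"
  using assms by (metis UnE concE inflB_Suc)

lemma length_inflA_inflB:
  "(u \<in> inflA n \<longrightarrow> length u = fib (2 * n)) \<and> (v \<in> inflB n \<longrightarrow> length v = fib (2 * n - 1))"
proof (induction n arbitrary: u v)
  case (Suc n)
  show ?case
  proof (cases n)
    case 0
    then show ?thesis by (simp add: numeral_2_eq_2)
  next
    case (Suc m)
    then have n: "n \<ge> 1" by simp
    have A: "length u = fib (2 * n)" if "u \<in> inflA n" for u
      using Suc.IH that by blast
    have B: "length u = fib (2 * n - 1)" if "u \<in> inflB n" for u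
      using Suc.IH that by blast
    have 1: "fib (2 * Suc n) = fib (2 * n - 1) + fib (2 * n) + fib (2 * n)"
      and 2: "fib (2 * Suc n - 1) = fib (2 * n - 1) + fib (2 * n)"
      using Suc by simp_all
    show ?thesis unfolding 1 2
      by (auto elim!: inflA_SucE[OF _ n] inflB_SucE[OF _ n] simp: A B)
  qed
qed simp

lemma length_inflA: "u \<in> inflA n \<Longrightarrow> length u = fib (2 * n)"
  and length_inflB: "v \<in> inflB n \<Longrightarrow> length v = fib (2 * n - 1)"
  using length_inflA_inflB by blast+

lemma finite_inflA: "finite (inflA n)" and finite_inflB: "finite (inflB n)"
proof (induction n)
  case (Suc n)
  {
    case 1
    show ?case using Suc by (cases n) (simp_all add: finite_conc)
  next
    case 2
    show ?case using Suc by (cases n) (simp_all add: finite_conc)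
  }
qed simp_all

lemma inflA_ne: "n \<ge> 1 \<Longrightarrow> inflA n \<noteq> {}" and inflB_ne: "n \<ge> 1 \<Longrightarrow> inflB n \<noteq> {}"
proof -
  have "inflA n \<noteq> {} \<and> inflB n \<noteq> {}" if "n \<ge> 1" for n
    using that
  proof (induction rule: dec_induct)
    case (step n)
    then show ?case by (simp add: inflA_Suc inflB_Suc conc_eq_empty_iff)
  qed simp
  then show "n \<ge> 1 \<Longrightarrow> inflA n \<noteq> {}" "n \<ge> 1 \<Longrightarrow> inflB n \<noteq> {}"
    by blast+
qed

lemma infl_starts_with_block:
  assumes "v \<in> inflA (Suc n) \<union> inflB (Suc n)" "n \<ge> 1"
  obtains b v' where "v = b @ v'" "b \<in> inflA n \<union> inflB n"
  using assms by (auto elim!: inflA_SucE inflB_SucE)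

text \<open>
  The case \<open>v \<in> B\<^sub>n\<close> is the disjointness of \<open>A\<^sub>nB\<^sub>n\<close> and \<open>B\<^sub>nA\<^sub>n\<close>. It does not carry an induction
  alone: after cancelling a common prefix of \<open>BAA\<cdot>v\<close> and \<open>BA\<cdot>BAA\<close> one has to separate \<open>A\<cdot>v\<close> from
  \<open>BAA\<close> at the lower level, and \<open>v\<close> can start there with an \<open>A\<close> block as well as with a \<open>B\<close> block.
  Hence both kinds of \<open>v\<close> are treated at once, with prefixes in place of equality.
\<close>

lemma block_pairs_disagree:
  assumes "n \<ge> 1" "u \<in> inflA n" "v \<in> inflA n \<union> inflB n" "u' \<in> inflB n" "v' \<in> inflA n"
  shows "\<not> prefix (u' @ v') (u @ v)"
  using assms
proof (induction n arbitrary: u v u' v' rule: dec_induct)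
  case base
  then show ?case by auto
next
  case (step n)
  note n = \<open>n \<ge> 1\<close>
  from step.prems(1) n obtain x y z
    where u: "u = x @ y @ z" "x \<in> inflB n" "y \<in> inflA n" "z \<in> inflA n"
    by (rule inflA_SucE)
  from step.prems(4) n obtain r s t
    where v': "v' = r @ s @ t" "r \<in> inflB n" "s \<in> inflA n" "t \<in> inflA n"
    by (rule inflA_SucE)
  from step.prems(2) n obtain b v'' where v: "v = b @ v''" "b \<in> inflA n \<union> inflB n"
    by (rule infl_starts_with_block)
  show ?case
  proof
    assume pre: "prefix (u' @ v') (u @ v)"
    from step.prems(3) n show False
    proof (cases rule: inflB_SucE)
      case (1 p q)
      \<comment> \<open>The pattern \<open>AB\<close> of \<open>u'\<close> meets the pattern \<open>BA\<close> at the start of \<open>u\<close>.\<close>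
      then have "length (p @ q) = length (x @ y)"
        using u by (simp add: length_inflA length_inflB)
      then have "p @ q = x @ y"
        using pre u 1 by (auto simp: prefix_def append_eq_append_conv2)
      moreover have "\<not> prefix (x @ y) (p @ q)"
        using step.IH 1 u by blast
      ultimately show False by simp
    next
      case (2 p q)
      \<comment> \<open>Both sides start with \<open>BA\<close>; behind it, \<open>BA\<close> meets \<open>A\<close> followed by the first block of \<open>v\<close>.\<close>
      then have "length p = length x" "length q = length y"
        using u by (simp_all add: length_inflA length_inflB)
      then have "prefix (r @ s @ t) (z @ b @ v'')"
        using pre u 2 v v' by (auto simp: prefix_def)
      then have 3: "prefix (r @ s) ((z @ b) @ v'')"
        by (auto simp: prefix_def)
      have "fib (2 * n - 1) \<le> length b"
        using v by (auto simp: length_inflA length_inflB fib_mono)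
      then have "length (r @ s) \<le> length (z @ b)"
        using u v' by (simp add: length_inflA length_inflB)
      then have "prefix (r @ s) (z @ b)"
        using 3 by (meson prefixI prefix_length_prefix)
      moreover have "\<not> prefix (r @ s) (z @ b)"
        using step.IH u v v' by blast
      ultimately show False by simp
    qed
  qed
qed

lemma inflB_branches_disjoint:
  assumes "n \<ge> 1"
  shows "inflA n \<cdot> inflB n \<inter> inflB n \<cdot> inflA n = {}"
proof -
  have False if "w \<in> inflA n \<cdot> inflB n" "w \<in> inflB n \<cdot> inflA n" for w
  proof -
    obtain u v where "w = u @ v" "u \<in> inflA n" "v \<in> inflB n"
      using \<open>w \<in> inflA n \<cdot> inflB n\<close> by (rule concE)
    moreover obtain u' v' where "w = u' @ v'" "u' \<in> inflB n" "v' \<in> inflA n"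
      using \<open>w \<in> inflB n \<cdot> inflA n\<close> by (rule concE)
    ultimately show False
      using block_pairs_disagree[OF assms, of u v u' v'] by simp
  qed
  then show ?thesis by blast
qed

text \<open>
  With \<open>\<alpha>\<^sub>n\<close> and \<open>\<beta>\<^sub>n\<close> the base-2 logarithms of the cardinalities, the recursion is
  \<open>\<alpha>\<^sub>n\<^sub>+\<^sub>1 = \<beta>\<^sub>n + 2\<alpha>\<^sub>n\<close> and \<open>\<beta>\<^sub>n\<^sub>+\<^sub>1 = 1 + \<alpha>\<^sub>n + \<beta>\<^sub>n\<close>, the summand 1 counting the choice between
  two disjoint branches. The corrections \<open>-1\<close> and \<open>+1\<close> form a fixed point of this affine map.
\<close>

lemma card_infl:
  "card (inflA (n + 2)) = 2 ^ (fib (2 * n + 1) - 1) \<and> card (inflB (n + 2)) = 2 ^ (fib (2 * n) + 1)"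
proof (induction n)
  case 0
  show ?case by (auto simp: numeral_2_eq_2 conc_def card_insert_if)
next
  case (Suc n)
  let ?A = "inflA (n + 2)" and ?B = "inflB (n + 2)"
  have A: "inflA (Suc n + 2) = ?B \<cdot> ?A \<cdot> ?A" and B: "inflB (Suc n + 2) = ?A \<cdot> ?B \<union> ?B \<cdot> ?A"
    by simp_all
  have "card (inflA (Suc n + 2)) = card ?B * (card ?A * card ?A)"
    unfolding A by (simp only: card_conc[OF length_inflA] card_conc[OF length_inflB])
  also have "\<dots> = 2 ^ (fib (2 * n) + 1 + (fib (2 * n + 1) - 1) + (fib (2 * n + 1) - 1))"
    using Suc by (simp only: power_add mult.assoc)
  also have "fib (2 * n) + 1 + (fib (2 * n + 1) - 1) + (fib (2 * n + 1) - 1)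
      = fib (2 * Suc n + 1) - 1"
    using fib_neq_0_nat[of "2 * n + 1"] by simp
  finally have cA: "card (inflA (Suc n + 2)) = 2 ^ (fib (2 * Suc n + 1) - 1)" .
  have "card (inflB (Suc n + 2)) = card (?A \<cdot> ?B) + card (?B \<cdot> ?A)"
    unfolding B by (intro card_Un_disjoint inflB_branches_disjoint finite_conc finite_inflA finite_inflB)
      simp
  also have "\<dots> = 2 * card ?A * card ?B"
    by (simp add: card_conc[OF length_inflA] card_conc[OF length_inflB] del: One_nat_def add_2_eq_Suc')
  also have "\<dots> = 2 ^ (1 + (fib (2 * n + 1) - 1) + (fib (2 * n) + 1))"
    using Suc by (simp only: power_add power_one_right)
  also have "1 + (fib (2 * n + 1) - 1) + (fib (2 * n) + 1) = fib (2 * Suc n) + 1"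
    using fib_neq_0_nat[of "2 * n + 1"] by simp
  finally show ?case using cA by simp
qed

section \<open>The limit sets and their block structure\<close>

text \<open>
  The branch \<open>B\<^sub>nA\<^sub>n\<close> is immediate; in the branch \<open>A\<^sub>nB\<^sub>n\<close> the word \<open>A\<^sub>n = B\<^sub>n\<^sub>-\<^sub>1A\<^sub>n\<^sub>-\<^sub>1A\<^sub>n\<^sub>-\<^sub>1\<close> starts with
  \<open>B\<^sub>n\<^sub>-\<^sub>1A\<^sub>n\<^sub>-\<^sub>1 \<subseteq> B\<^sub>n\<close>. For \<open>n = 1\<close> the claim fails: \<open>ab \<in> B\<^sub>2\<close> does not start with \<open>b\<close>.
\<close>

lemma take_inflB_Suc:
  assumes "n \<ge> 2" "u \<in> inflB (Suc n)"
  shows "take (fib (2 * n - 1)) u \<in> inflB n"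
proof -
  obtain m where n: "n = Suc m" and m: "m \<ge> 1"
    using assms(1) by (cases n) auto
  have n1: "n \<ge> 1" using assms by simp
  from assms(2) n1 show ?thesis
  proof (cases rule: inflB_SucE)
    case (1 a b)
    from 1(2) obtain x y z where a: "a = x @ y @ z" "x \<in> inflB m" "y \<in> inflA m"
      unfolding n using m by (rule inflA_SucE)
    have xy: "x @ y \<in> inflB n"
      unfolding n inflB_Suc[OF m] using concI[of x _ y] a by blast
    have "take (length (x @ y)) ((x @ y) @ z @ b) = x @ y"
      by (rule append_eq_conv_conj[THEN iffD1, THEN conjunct1, symmetric]) (rule refl)
    then have "take (fib (2 * n - 1)) u = x @ y"
      unfolding length_inflB[OF xy] 1 a by simp
    then show ?thesis using xy by simp
  next
    case (2 b a)
    then show ?thesis by (simp add: length_inflB)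
  qed
qed

lemma take_inflB:
  assumes "2 \<le> j" "j \<le> k" "u \<in> inflB k"
  shows "take (fib (2 * j - 1)) u \<in> inflB j"
  using assms(2,1,3)
proof (induction arbitrary: u rule: dec_induct)
  case base
  then show ?case by (simp add: length_inflB)
next
  case (step k)
  have "take (fib (2 * k - 1)) u \<in> inflB k"
    using take_inflB_Suc[of k u] step by simp
  then have "take (fib (2 * j - 1)) (take (fib (2 * k - 1)) u) \<in> inflB j"
    using step by blast
  moreover have "fib (2 * j - 1) \<le> fib (2 * k - 1)"
    using step by (intro fib_mono) simp
  ultimately show ?case by (simp add: min_def)
qed

lemma stream_of_prefix_chain:
  fixes W :: "nat \<Rightarrow> 'a list"
  assumes "\<And>k. prefix (W k) (W (Suc k))" and "\<And>k. k < length (W k)"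
  obtains w where "\<And>k. stake (length (W k)) w = W k"
proof
  define w where "w = smap (\<lambda>i. W i ! i) nats"
  have mono: "prefix (W j) (W k)" if "j \<le> k" for j k
    using that
  proof (induction rule: dec_induct)
    case (step k)
    then show ?case using assms(1)[of k] prefix_order.order_trans by blast
  qed simp
  have nth: "W i ! i = W k ! i" if "i < length (W k)" for i k
  proof (cases "i \<le> k")
    case True
    from mono[OF this] assms(2)[of i] show ?thesis
      by (auto simp: prefix_def nth_append)
  next
    case False
    then have "prefix (W k) (W i)" using mono by simp
    then show ?thesis using that by (auto simp: prefix_def nth_append)
  qed
  show "stake (length (W k)) w = W k" for k
    by (rule nth_equalityI) (auto simp: w_def nth)
qed

lemma fib_ge: "n \<le> fib (Suc n)"
proof (induction n rule: fib.induct)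
  case (3 n)
  have "fib (Suc n) > 0" by (simp add: fib_neq_0_nat)
  then show ?case using 3 by simp
qed simp_all

text \<open>
  Appending words of \<open>A\<^sub>n, A\<^sub>n\<^sub>+\<^sub>1, \<dots>\<close> in turn keeps the word in \<open>B\<^sub>n\<^sub>+\<^sub>1, B\<^sub>n\<^sub>+\<^sub>2, \<dots>\<close>, so the resulting
  infinite word satisfies the conditions of \<open>B\<close> from level \<open>n\<close> on; the conditions at lower levels
  follow since prefixes of words in \<open>B\<^sub>k\<close> are in the earlier sets \<open>B\<^sub>j\<close>.
\<close>

lemma inflB_extends_to_limB:
  assumes n: "n \<ge> 3" and u: "u \<in> inflB n"
  obtains w where "w \<in> limB" "stake (fib (2 * n - 1)) w = u"
proof -
  define W where "W = rec_nat u (\<lambda>k x. x @ (SOME a. a \<in> inflA (n + k)))"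
  have W0: "W 0 = u" and WS: "W (Suc k) = W k @ (SOME a. a \<in> inflA (n + k))" for k
    by (simp_all add: W_def)
  have WB: "W k \<in> inflB (n + k)" for k
  proof (induction k)
    case 0
    then show ?case by (simp add: W0 u)
  next
    case (Suc k)
    have nk: "n + k \<ge> 1" using n by simp
    have "(SOME a. a \<in> inflA (n + k)) \<in> inflA (n + k)"
      using inflA_ne[OF nk] by (simp add: some_in_eq)
    with Suc.IH have "W (Suc k) \<in> inflB (n + k) \<cdot> inflA (n + k)"
      unfolding WS by (rule concI)
    then show ?case
      using inflB_Suc[OF nk] by simp
  qed
  have len: "length (W k) = fib (2 * (n + k) - 1)" for k
    using WB by (rule length_inflB)
  have "k < length (W k)" for k
  proof -
    have "2 * (n + k) - 1 = Suc (2 * (n + k) - 2)" using n by simp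
    then have "2 * (n + k) - 2 \<le> length (W k)"
      unfolding len using fib_ge by metis
    then show ?thesis using n by simp
  qed
  moreover have "prefix (W k) (W (Suc k))" for k by (simp add: WS)
  ultimately obtain w where w: "\<And>k. stake (length (W k)) w = W k"
    by (metis stream_of_prefix_chain)
  have "stake (fib (2 * j - 1)) w \<in> inflB j" if "j \<ge> 3" for j
  proof -
    have "take (fib (2 * j - 1)) (W j) \<in> inflB j"
      using take_inflB[OF _ _ WB] that by simp
    moreover have "fib (2 * j - 1) \<le> length (W j)"
      unfolding len by (rule fib_mono) simp
    ultimately show ?thesis
      using w[of j] by (metis take_stake min.absorb1)
  qed
  then have "w \<in> limB" by (simp add: limB_def)
  moreover have "stake (fib (2 * n - 1)) w = u"
    using w[of 0] by (simp add: W0 length_inflB[OF u])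
  ultimately show ?thesis by (rule that)
qed

text \<open>
  This is where the \<open>-1\<close> in the definition of \<open>A\<close> comes from. A word \<open>xyz \<in> B\<^sub>nA\<^sub>nA\<^sub>n\<close> has
  \<open>xy \<in> B\<^sub>n\<^sub>+\<^sub>1\<close>, and \<open>z\<close> without its last letter is again a prefix of \<open>B\<^sub>nA\<^sub>n\<close>, which starts
  \<open>A\<^sub>n\<^sub>+\<^sub>1\<close>. The last letter itself cannot be kept: \<open>a \<in> A\<^sub>1\<close>, while \<open>ba\<close> is the only word of
  \<open>B\<^sub>1A\<^sub>1\<close>.
\<close>

lemma butlast_inflA_prefix:
  assumes "n \<ge> 1" "u \<in> inflA n"
  shows "\<exists>b\<in>inflB n. \<exists>a\<in>inflA n. prefix (butlast u) (b @ a)"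
  using assms
proof (induction n arbitrary: u rule: dec_induct)
  case base
  then show ?case by simp
next
  case (step n)
  from step.prems \<open>n \<ge> 1\<close> obtain x y z
    where u: "u = x @ y @ z" "x \<in> inflB n" "y \<in> inflA n" "z \<in> inflA n"
    by (rule inflA_SucE)
  from step.IH[OF u(4)] obtain b a
    where ba: "b \<in> inflB n" "a \<in> inflA n" "prefix (butlast z) (b @ a)" by blast
  have "z \<noteq> []"
    using length_inflA[OF u(4)] fib_neq_0_nat[of "2 * n"] \<open>n \<ge> 1\<close> by auto
  then have "butlast u = (x @ y) @ butlast z"
    by (simp add: u butlast_append)
  then have "prefix (butlast u) ((x @ y) @ (b @ a @ a))"
    using ba(3) by (metis append_assoc prefix_prefix same_prefix_prefix)
  moreover have "x @ y \<in> inflB (Suc n)"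
    unfolding inflB_Suc[OF \<open>n \<ge> 1\<close>] using concI[of x _ y] u by blast
  moreover have "b @ a @ a \<in> inflA (Suc n)"
    using ba \<open>n \<ge> 1\<close> by (simp add: inflA_SucI)
  ultimately show ?case by blast
qed

text \<open>
  A word of \<open>B\<^sub>n\<close> starting with \<open>B\<^sub>n\<^sub>-\<^sub>1A\<^sub>n\<^sub>-\<^sub>1\<close> is a prefix of a word in \<open>A\<^sub>n\<close>. If it starts with
  \<open>A\<^sub>n\<^sub>-\<^sub>1\<close> instead, the \<open>f\<^sub>2\<^sub>n\<^sub>-\<^sub>2 - 1\<close> letters that matter are that block without its last letter, and
  the preceding lemma applies.
\<close>

lemma limB_subset_limA: "limB \<subseteq> limA"
proof
  fix w assume w: "w \<in> limB"
  have "stake (fib (2 * n - 2) - 1) w \<in> take (fib (2 * n - 2) - 1) ` inflA n" if "n \<ge> 3" for n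
  proof -
    define m where "m = n - 1"
    then have n: "n = Suc m" and m: "m \<ge> 1"
      using that by simp_all
    let ?l = "fib (2 * n - 2) - 1"
    define v where "v = stake (fib (2 * n - 1)) w"
    have "fib (2 * n - 2) \<le> fib (2 * n - 1)" by (rule fib_mono) simp
    then have st: "stake ?l w = take ?l v"
      by (simp add: v_def take_stake min_def)
    have "v \<in> inflB (Suc m)"
      using w that by (simp add: limB_def v_def flip: n)
    then have "\<exists>b\<in>inflB m. \<exists>a\<in>inflA m. prefix (take ?l v) (b @ a)"
      using m
    proof (cases rule: inflB_SucE)
      case (1 x y)
      have "take ?l v = butlast x"
        using 1 by (simp add: n length_inflA butlast_conv_take)
      then show ?thesis using butlast_inflA_prefix[OF m 1(2)] by simp
    next
      case (2 x y)
      then show ?thesis using take_is_prefix by blast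
    qed
    then obtain b a where ba: "b \<in> inflB m" "a \<in> inflA m" "prefix (take ?l v) (b @ a)"
      by blast
    have "length (take ?l v) = ?l"
      using st by (metis length_stake)
    moreover obtain c where "b @ a = take ?l v @ c"
      using ba(3) by (auto simp: prefix_def)
    then have "b @ a @ a = take ?l v @ (c @ a)"
      by (metis append_assoc)
    ultimately have "take ?l v = take ?l (b @ a @ a)"
      by (metis append_eq_conv_conj)
    moreover have "b @ a @ a \<in> inflA n"
      using ba m by (simp add: n inflA_SucI)
    ultimately show ?thesis unfolding st by (metis imageI)
  qed
  then show "w \<in> limA" by (simp add: limA_def)
qed

lemma infl_concat_blocks:
  assumes "1 \<le> n" "n \<le> N"
  shows "inflA N \<union> inflB N \<subseteq> concat ` lists (inflA n \<union> inflB n)"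
  using assms(2)
proof (induction rule: dec_induct)
  case base
  show ?case
  proof
    fix u assume "u \<in> inflA n \<union> inflB n"
    then have "[u] \<in> lists (inflA n \<union> inflB n)" by simp
    moreover have "u = concat [u]" by simp
    ultimately show "u \<in> concat ` lists (inflA n \<union> inflB n)" by (rule rev_image_eqI)
  qed
next
  case (step N)
  let ?S = "concat ` lists (inflA n \<union> inflB n)"
  have app: "u @ v \<in> ?S" if "u \<in> ?S" "v \<in> ?S" for u v
  proof -
    from that obtain us vs where "us \<in> lists (inflA n \<union> inflB n)" "vs \<in> lists (inflA n \<union> inflB n)"
      "u = concat us" "v = concat vs" by blast
    then show ?thesis
      by (intro rev_image_eqI[of "us @ vs"]) auto
  qed
  have N: "N \<ge> 1" using step assms by simp
  have S: "u \<in> ?S" if "u \<in> inflA N \<or> u \<in> inflB N" for u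
    using that step.IH by blast
  show ?case
  proof
    fix u assume "u \<in> inflA (Suc N) \<union> inflB (Suc N)"
    then show "u \<in> ?S"
    proof
      assume "u \<in> inflA (Suc N)"
      then show ?thesis using N by (rule inflA_SucE) (simp only: app S simp_thms)
    next
      assume "u \<in> inflB (Suc N)"
      then show ?thesis using N by (rule inflB_SucE) (simp_all only: app S simp_thms)
    qed
  qed
qed

text \<open>
  Any finite prefix of a word in \<open>A\<close> is already a prefix of an inflated word of some high
  generation, and that word decomposes into blocks of generation \<open>n\<close>.
\<close>

lemma limA_prefix_of_blocks:
  assumes "w \<in> limA" "n \<ge> 1"
  shows "\<exists>bs\<in>lists (inflA n \<union> inflB n). prefix (stake m w) (concat bs)"
proof -
  define N where "N = m + n + 3"
  define l where "l = fib (2 * N - 2) - 1"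
  have "N \<ge> 3" by (simp add: N_def)
  have "2 * N - 2 = Suc (2 * N - 3)" by (simp add: N_def)
  then have "2 * N - 3 \<le> fib (2 * N - 2)" using fib_ge by metis
  then have ml: "m \<le> l" by (simp add: l_def N_def)
  have "stake l w \<in> take l ` inflA N"
    using assms(1) \<open>N \<ge> 3\<close> unfolding limA_def l_def by blast
  then obtain v where v: "v \<in> inflA N" "stake l w = take l v" by blast
  have "v \<in> concat ` lists (inflA n \<union> inflB n)"
    using infl_concat_blocks[of n N] v assms(2) by (auto simp: N_def)
  moreover have "stake m w = take m v"
    using v(2) ml by (metis take_stake take_take min.absorb1)
  ultimately show ?thesis using take_is_prefix by force
qed


section \<open>A lower bound for the number of factors\<close>

lemma finite_words_of_length: "finite {u :: 'a::finite list. length u = m}"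
  and card_words_of_length: "card {u :: 'a::finite list. length u = m} = CARD('a) ^ m"
  using finite_lists_length_eq[of "UNIV :: 'a set" m] card_lists_length_eq[of "UNIV :: 'a set" m]
  by simp_all

lemma factors_subset_words: "factors S m \<subseteq> {u. length u = m}"
  by (auto simp: factors_def)

lemma finite_factors: "finite (factors (S :: 'a::finite stream set) m)"
  by (rule finite_subset[OF factors_subset_words finite_words_of_length])

lemma factors_mono: "S \<subseteq> T \<Longrightarrow> factors S m \<subseteq> factors T m"
  by (auto simp: factors_def)

lemma factors_ne: "S \<noteq> {} \<Longrightarrow> factors S m \<noteq> {}"
  by (auto simp: factors_def)

lemma factors_add_subset: "factors S (j + k) \<subseteq> factors S j \<cdot> factors S k"
proof
  fix u assume "u \<in> factors S (j + k)"
  then obtain i w where w: "w \<in> S" "u = stake (j + k) (sdrop i w)"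
    by (auto simp: factors_def)
  have "u = stake j (sdrop i w) @ stake k (sdrop (i + j) w)"
    unfolding w(2) stake_add[symmetric] by (simp add: sdrop_add)
  moreover have "stake j (sdrop i w) \<in> factors S j" "stake k (sdrop (i + j) w) \<in> factors S k"
    using w by (auto simp: factors_def)
  ultimately show "u \<in> factors S j \<cdot> factors S k" by (simp add: concI)
qed

lemma card_factors_add_le:
  fixes S :: "'a::finite stream set"
  shows "card (factors S (j + k)) \<le> card (factors S j) * card (factors S k)"
  using card_mono[OF finite_conc factors_add_subset] card_conc_le finite_factors
  by (metis order_trans)

lemma card_factors_mult_le:
  fixes S :: "'a::finite stream set"
  shows "card (factors S (q * m + r)) \<le> card (factors S m) ^ q * card (factors S r)"
proof (induction q)
  case (Suc q)
  have "card (factors S (Suc q * m + r)) \<le> card (factors S m) * card (factors S (q * m + r))"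
    using card_factors_add_le[of S m "q * m + r"] by (simp add: add.assoc)
  also have "\<dots> \<le> card (factors S m) * (card (factors S m) ^ q * card (factors S r))"
    using Suc by (intro mult_left_mono) auto
  finally show ?case by (simp add: mult.assoc)
qed simp

text \<open>
  Submultiplicativity turns a lower bound along the lengths \<open>l n\<close> into one for every length \<open>m\<close>:
  cutting a factor of length \<open>l n\<close> into pieces of length \<open>m\<close> and a remainder gives
  \<open>ln |W n| \<le> (l n / m) ln F(m) + K\<close>, where the constant \<open>K\<close> bounds the contribution of the remainder
  and disappears after division by \<open>l n\<close>.
\<close>

lemma ln_card_factors_ge:
  fixes S :: "'a::finite stream set" and l :: "nat \<Rightarrow> nat"
  assumes W: "eventually (\<lambda>n. W n \<noteq> {} \<and> W n \<subseteq> factors S (l n)) sequentially"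
    and l: "filterlim l at_top sequentially"
    and h: "(\<lambda>n. ln (real (card (W n))) / real (l n)) \<longlonglongrightarrow> h"
    and m: "m > 0"
  shows "h \<le> ln (real (card (factors S m))) / real m"
proof -
  define f where "f k = card (factors S k)" for k
  from eventually_happens'[OF _ W] have "S \<noteq> {}"
    by (auto simp: factors_def)
  then have f1: "f k \<ge> 1" for k
    unfolding f_def by (metis One_nat_def Suc_leI card_gt_0_iff factors_ne finite_factors)
  define K where "K = real m * ln (real CARD('a))"
  have lf: "ln (real (f k)) \<le> K" if "k \<le> m" for k
  proof -
    have "f k \<le> CARD('a) ^ k"
      unfolding f_def card_words_of_length[symmetric]
      by (rule card_mono[OF finite_words_of_length factors_subset_words])
    also have "\<dots> \<le> CARD('a) ^ m"
      using that by (intro power_increasing) simp_all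
    finally have "real (f k) \<le> real CARD('a) ^ m"
      by (metis of_nat_le_iff of_nat_power)
    then have "ln (real (f k)) \<le> ln (real CARD('a) ^ m)"
      using f1[of k] by (subst ln_le_cancel_iff) auto
    then show ?thesis by (simp add: K_def ln_realpow)
  qed
  have bound: "ln (real (card (W n))) / real (l n) \<le> ln (real (f m)) / real m + K / real (l n)"
    if n: "W n \<noteq> {} \<and> W n \<subseteq> factors S (l n)" and l0: "l n > 0" for n
  proof -
    have "card (W n) > 0"
      using n finite_subset[OF _ finite_factors] by (auto simp: card_gt_0_iff)
    moreover have "card (W n) \<le> f (l n)"
      unfolding f_def using n by (intro card_mono finite_factors) simp
    moreover have "f (l n) \<le> f m ^ (l n div m) * f (l n mod m)"
      using card_factors_mult_le[of S "l n div m" m "l n mod m"] by (simp add: f_def)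
    ultimately have "card (W n) > 0" "real (card (W n)) \<le> real (f m) ^ (l n div m) * real (f (l n mod m))"
      by (simp, metis of_nat_le_iff of_nat_mult of_nat_power order_trans)
    then have "ln (real (card (W n))) \<le> ln (real (f m) ^ (l n div m) * real (f (l n mod m)))"
      by (subst ln_le_cancel_iff) auto
    also have "\<dots> = real (l n div m) * ln (real (f m)) + ln (real (f (l n mod m)))"
      using f1[of m] f1[of "l n mod m"] by (simp add: ln_mult ln_realpow)
    also have "\<dots> \<le> (real (l n) / real m) * ln (real (f m)) + K"
    proof (intro add_mono mult_right_mono)
      show "ln (real (f (l n mod m))) \<le> K"
        using m by (intro lf) (simp add: less_imp_le)
      show "0 \<le> ln (real (f m))" using f1[of m] by simp
      show "real (l n div m) \<le> real (l n) / real m" by (simp add: of_nat_div_le_of_nat)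
    qed
    finally show ?thesis using l0 by (simp add: field_simps)
  qed
  have "(\<lambda>n. ln (real (f m)) / real m + K / real (l n)) \<longlonglongrightarrow> ln (real (f m)) / real m + 0"
    by (intro tendsto_intros real_tendsto_divide_at_top[OF tendsto_const]
        filterlim_compose[OF filterlim_real_sequentially l])
  moreover have "eventually (\<lambda>n. ln (real (card (W n))) / real (l n)
      \<le> ln (real (f m)) / real m + K / real (l n)) sequentially"
    using W eventually_compose_filterlim[OF eventually_gt_at_top[of 0] l]
    by eventually_elim (rule bound)
  ultimately show ?thesis
    using tendsto_le[OF _ _ h] by (fastforce simp: f_def)
qed

section \<open>An upper bound for the number of factors\<close>

definition block_prefixes :: "'a list set \<Rightarrow> nat \<Rightarrow> 'a list set" where
  "block_prefixes L m = {u. length u = m \<and> (\<exists>bs\<in>lists L. prefix u (concat bs))}"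

lemma finite_block_prefixes: "finite (block_prefixes (L :: 'a::finite list set) m)"
  by (rule finite_subset[OF _ finite_words_of_length[of m]]) (auto simp: block_prefixes_def)

lemma prefix_append_long:
  assumes "prefix p (b @ y)" "length b \<le> length p"
  obtains p' where "p = b @ p'" "prefix p' y"
proof (cases "prefix p b")
  case True
  then have "p = b"
    using assms(2) by (auto simp: prefix_def)
  then show ?thesis using that[of "[]"] by simp
next
  case False
  then show ?thesis using assms(1) that by (auto simp: prefix_append)
qed

lemma block_prefixes_split:
  assumes "\<And>b. b \<in> L \<Longrightarrow> length b < m" and "m > 0"
  shows "block_prefixes L m \<subseteq> (\<Union>b\<in>L. (@) b ` block_prefixes L (m - length b))"
proof
  fix u assume "u \<in> block_prefixes L m"
  then obtain bs where bs: "bs \<in> lists L" "prefix u (concat bs)" "length u = m"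
    by (auto simp: block_prefixes_def)
  from bs \<open>m > 0\<close> obtain b bs' where b: "bs = b # bs'"
    by (cases bs) auto
  then have "prefix u (b @ concat bs')" "length b \<le> length u"
    using bs assms(1)[of b] by auto
  then obtain u' where u': "u = b @ u'" "prefix u' (concat bs')"
    by (rule prefix_append_long)
  then have "u' \<in> block_prefixes L (m - length b)"
    using bs b by (auto simp: block_prefixes_def)
  then show "u \<in> (\<Union>b\<in>L. (@) b ` block_prefixes L (m - length b))"
    using u' bs b by auto
qed

text \<open>
  Splitting off the first block gives \<open>P(m) \<le> (\<Sum>b\<in>L. P(m - |b|))\<close> for the number \<open>P(m)\<close> of
  prefixes, and the hypothesis on \<open>\<rho>\<close> says exactly that \<open>c \<rho>\<^sup>m\<close> is a supersolution of this recursion.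
\<close>

lemma card_block_prefixes_le:
  fixes L :: "'a::finite list set" and \<rho> :: real
  assumes fin: "finite L" and ne: "[] \<notin> L" and \<rho>: "1 \<le> \<rho>"
    and kraft: "(\<Sum>b\<in>L. 1 / \<rho> ^ length b) \<le> 1"
  shows "\<exists>c. \<forall>m. real (card (block_prefixes L m)) \<le> c * \<rho> ^ m"
proof -
  define M where "M = (\<Sum>b\<in>L. length b)"
  have M: "length b \<le> M" if "b \<in> L" for b
    unfolding M_def using fin that by (intro member_le_sum) simp_all
  \<comment> \<open>Large enough for the lengths up to \<open>M\<close>, where possibly no whole block fits.\<close>
  define c where "c = real (CARD('a) ^ M)"
  have "real (card (block_prefixes L m)) \<le> c * \<rho> ^ m" for m
  proof (induction m rule: less_induct)
    case (less m)
    show ?case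
    proof (cases "m \<le> M")
      case True
      have "card (block_prefixes L m) \<le> CARD('a) ^ m"
        unfolding card_words_of_length[symmetric]
        by (rule card_mono[OF finite_words_of_length]) (auto simp: block_prefixes_def)
      also have "\<dots> \<le> CARD('a) ^ M"
        using True by (intro power_increasing) simp_all
      finally have "real (card (block_prefixes L m)) \<le> c"
        unfolding c_def by (rule of_nat_mono)
      also have "\<dots> \<le> c * \<rho> ^ m"
        using \<rho> mult_left_mono[of 1 "\<rho> ^ m" c] by (simp add: c_def)
      finally show ?thesis .
    next
      case False
      have "card (block_prefixes L m) \<le> card (\<Union>b\<in>L. (@) b ` block_prefixes L (m - length b))"
        using False M fin
        by (intro card_mono block_prefixes_split finite_UN_I finite_imageI finite_block_prefixes)
          (fastforce dest: M)+
      also have "\<dots> \<le> (\<Sum>b\<in>L. card ((@) b ` block_prefixes L (m - length b)))"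
        by (rule card_UN_le[OF fin])
      also have "\<dots> \<le> (\<Sum>b\<in>L. card (block_prefixes L (m - length b)))"
        by (intro sum_mono card_image_le finite_block_prefixes)
      finally have "real (card (block_prefixes L m))
          \<le> (\<Sum>b\<in>L. real (card (block_prefixes L (m - length b))))"
        by (metis of_nat_mono of_nat_sum)
      also have "\<dots> \<le> (\<Sum>b\<in>L. c * \<rho> ^ m * (1 / \<rho> ^ length b))"
      proof (rule sum_mono)
        fix b assume b: "b \<in> L"
        then have "b \<noteq> []" "length b \<le> m" using ne M[of b] False by auto
        then have "real (card (block_prefixes L (m - length b))) \<le> c * \<rho> ^ (m - length b)"
          using False by (intro less.IH) auto
        also have "\<rho> ^ (m - length b) = \<rho> ^ m * (1 / \<rho> ^ length b)"
          using \<open>length b \<le> m\<close> \<rho> by (simp add: power_diff)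
        finally show "real (card (block_prefixes L (m - length b)))
            \<le> c * \<rho> ^ m * (1 / \<rho> ^ length b)" by (simp only: mult.assoc)
      qed
      also have "\<dots> = c * \<rho> ^ m * (\<Sum>b\<in>L. 1 / \<rho> ^ length b)"
        by (rule sum_distrib_left[symmetric])
      also have "\<dots> \<le> c * \<rho> ^ m * 1"
        using kraft \<rho> by (intro mult_left_mono) (simp_all add: c_def)
      finally show ?thesis by simp
    qed
  qed
  then show ?thesis by blast
qed

text \<open>
  A factor starting at a late position \<open>i\<close> of a concatenation of blocks also starts at a position
  \<open>j \<le> M\<close> of another such concatenation: remove whole blocks from the front. This bounds the
  number of possible positions independently of the factor.
\<close>

lemma drop_block_prefix:
  assumes "bs \<in> lists L" "prefix p (concat bs)" "i \<le> length p" "\<And>b. b \<in> L \<Longrightarrow> length b \<le> M"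
  shows "\<exists>j\<le>M. drop i p \<in> drop j ` block_prefixes L (length p - i + j)"
proof (cases "i \<le> M")
  case True
  have "p \<in> block_prefixes L (length p - i + i)"
    using assms by (auto simp: block_prefixes_def)
  then show ?thesis using True by blast
next
  case False
  then show ?thesis
    using assms(1-3)
  proof (induction bs arbitrary: p i)
    case (Cons b bs)
    have b: "length b \<le> M" using Cons.prems(2) assms(4) by simp
    have "prefix p (b @ concat bs)" "length b \<le> length p"
      using Cons.prems b by auto
    then obtain p' where p': "p = b @ p'" "prefix p' (concat bs)"
      by (rule prefix_append_long)
    define i' where "i' = i - length b"
    have i': "drop i p = drop i' p'" "length p - i = length p' - i'" "i' \<le> length p'"
      using Cons.prems b by (auto simp: p' i'_def)
    show ?case
    proof (cases "i' \<le> M")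
      case True
      have "p' \<in> block_prefixes L (length p' - i' + i')"
        using Cons.prems(2) p' i'(3) by (auto simp: block_prefixes_def)
      then show ?thesis using True i' by auto
    next
      case False
      then show ?thesis using Cons.IH[of i' p'] Cons.prems(2) p' i' by simp
    qed
  qed auto
qed

lemma card_factors_le:
  fixes S :: "'a::finite stream set" and \<rho> :: real
  assumes fin: "finite L" and ne: "[] \<notin> L" and \<rho>: "1 \<le> \<rho>"
    and kraft: "(\<Sum>b\<in>L. 1 / \<rho> ^ length b) \<le> 1"
    and blocks: "\<And>w m. w \<in> S \<Longrightarrow> \<exists>bs\<in>lists L. prefix (stake m w) (concat bs)"
  shows "\<exists>c. \<forall>m. real (card (factors S m)) \<le> c * \<rho> ^ m"
proof -
  obtain c where c: "\<And>m. real (card (block_prefixes L m)) \<le> c * \<rho> ^ m"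
    using card_block_prefixes_le[OF fin ne \<rho> kraft] by blast
  define M where "M = (\<Sum>b\<in>L. length b)"
  have M: "length b \<le> M" if "b \<in> L" for b
    unfolding M_def using fin that by (intro member_le_sum) simp_all
  have sub: "factors S m \<subseteq> (\<Union>j\<le>M. drop j ` block_prefixes L (m + j))" for m
  proof
    fix u assume "u \<in> factors S m"
    then obtain i w where w: "w \<in> S" "u = stake m (sdrop i w)"
      by (auto simp: factors_def)
    have "u = drop i (stake (i + m) w)"
      by (simp add: w drop_stake)
    moreover obtain bs where "bs \<in> lists L" "prefix (stake (i + m) w) (concat bs)"
      using blocks[OF w(1)] by blast
    ultimately show "u \<in> (\<Union>j\<le>M. drop j ` block_prefixes L (m + j))"
      using drop_block_prefix[of bs L "stake (i + m) w" i M] M by auto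
  qed
  have "real (card (factors S m)) \<le> (\<Sum>j\<le>M. c * \<rho> ^ j) * \<rho> ^ m" for m
  proof -
    have "card (factors S m) \<le> card (\<Union>j\<le>M. drop j ` block_prefixes L (m + j))"
      using sub by (intro card_mono) (auto intro: finite_block_prefixes)
    also have "\<dots> \<le> (\<Sum>j\<le>M. card (drop j ` block_prefixes L (m + j)))"
      by (rule card_UN_le) simp
    also have "\<dots> \<le> (\<Sum>j\<le>M. card (block_prefixes L (m + j)))"
      by (intro sum_mono card_image_le finite_block_prefixes)
    finally have "real (card (factors S m)) \<le> (\<Sum>j\<le>M. real (card (block_prefixes L (m + j))))"
      by (metis of_nat_mono of_nat_sum)
    also have "\<dots> \<le> (\<Sum>j\<le>M. c * \<rho> ^ (m + j))"
      by (intro sum_mono c)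
    also have "\<dots> = (\<Sum>j\<le>M. c * \<rho> ^ j) * \<rho> ^ m"
      by (simp add: sum_distrib_left sum_distrib_right power_add mult_ac)
    finally show ?thesis .
  qed
  then show ?thesis by blast
qed

section \<open>Growth rates of sequences\<close>

text \<open>
  The constants \<open>c\<close> may depend on \<open>\<epsilon>\<close>; dividing \<open>ln c\<close> by \<open>m\<close> removes them.
\<close>

lemma ln_growth_tendsto:
  fixes f :: "nat \<Rightarrow> nat" and h :: real
  assumes pos: "\<And>m. f m > 0"
    and lower: "\<And>m. m > 0 \<Longrightarrow> h \<le> ln (real (f m)) / real m"
    and upper: "\<And>\<epsilon>. \<epsilon> > 0 \<Longrightarrow> \<exists>c. \<forall>m. real (f m) \<le> c * exp (h + \<epsilon>) ^ m"
  shows "(\<lambda>m. ln (real (f m)) / real m) \<longlonglongrightarrow> h"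
proof (rule order_tendstoI)
  fix a assume "a < h"
  then have "a < ln (real (f m)) / real m" if "m > 0" for m
    using lower[OF that] by simp
  then show "eventually (\<lambda>m. a < ln (real (f m)) / real m) sequentially"
    by (rule eventually_mono[OF eventually_gt_at_top])
next
  fix b assume "h < b"
  define \<epsilon> where "\<epsilon> = (b - h) / 2"
  have "\<epsilon> > 0" using \<open>h < b\<close> by (simp add: \<epsilon>_def)
  from upper[OF this] obtain c where c: "\<And>m. real (f m) \<le> c * exp (h + \<epsilon>) ^ m"
    by blast
  have c0: "c > 0" using c[of 0] pos[of 0] by simp
  have bound: "ln (real (f m)) / real m \<le> ln c / real m + (h + \<epsilon>)" if "m > 0" for m
  proof -
    have "ln (real (f m)) \<le> ln (c * exp (h + \<epsilon>) ^ m)"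
      using c[of m] pos[of m] c0 by (subst ln_le_cancel_iff) auto
    also have "\<dots> = ln c + real m * (h + \<epsilon>)"
      using c0 by (simp add: ln_mult ln_realpow)
    finally show ?thesis using that by (simp add: field_simps)
  qed
  have "(\<lambda>m. ln c / real m + (h + \<epsilon>)) \<longlonglongrightarrow> 0 + (h + \<epsilon>)"
    by (intro tendsto_intros real_tendsto_divide_at_top[OF tendsto_const] filterlim_real_sequentially)
  moreover have "0 + (h + \<epsilon>) < b" using \<open>h < b\<close> by (simp add: \<epsilon>_def field_simps)
  ultimately have "eventually (\<lambda>m. ln c / real m + (h + \<epsilon>) < b) sequentially"
    by (rule order_tendstoD(2))
  then show "eventually (\<lambda>m. ln (real (f m)) / real m < b) sequentially"
    using eventually_gt_at_top[of 0] by eventually_elim (rule order.strict_trans1[OF bound])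
qed

text \<open>
  The quotient is \<open>exp ((ln (c n) / l n - \<mu>) * l n)\<close>, whose exponent tends to \<open>-\<infinity>\<close>. The value one half
  lets two such weights, those of \<open>A\<^sub>n\<close> and of \<open>B\<^sub>n\<close>, add up to at most 1.
\<close>

lemma weight_eventually_le_half:
  fixes c l :: "nat \<Rightarrow> nat" and h \<mu> :: real
  assumes h: "(\<lambda>n. ln (real (c n)) / real (l n)) \<longlonglongrightarrow> h" and l: "filterlim l at_top sequentially"
    and "h < \<mu>"
  shows "eventually (\<lambda>n. real (c n) / exp \<mu> ^ l n \<le> 1 / 2) sequentially"
proof -
  have "(\<lambda>n. ln (real (c n)) / real (l n) - \<mu>) \<longlonglongrightarrow> h - \<mu>"
    by (intro tendsto_intros h)
  moreover have "filterlim (\<lambda>n. real (l n)) at_top sequentially"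
    by (rule filterlim_compose[OF filterlim_real_sequentially l])
  ultimately have "filterlim (\<lambda>n. (ln (real (c n)) / real (l n) - \<mu>) * real (l n)) at_bot sequentially"
    using \<open>h < \<mu>\<close> by (intro filterlim_tendsto_neg_mult_at_bot[of _ "h - \<mu>"]) simp_all
  then have "(\<lambda>n. exp ((ln (real (c n)) / real (l n) - \<mu>) * real (l n))) \<longlonglongrightarrow> 0"
    by (rule filterlim_compose[OF exp_at_bot])
  then have "eventually (\<lambda>n. exp ((ln (real (c n)) / real (l n) - \<mu>) * real (l n)) < 1 / 2) sequentially"
    by (rule order_tendstoD(2)) simp
  then show ?thesis
    using eventually_compose_filterlim[OF eventually_gt_at_top[of 0] l]
  proof eventually_elim
    case (elim n)
    show ?case
    proof (cases "c n = 0")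
      case False
      have "(ln (real (c n)) / real (l n) - \<mu>) * real (l n) = ln (real (c n)) - real (l n) * \<mu>"
        using elim(2) by (simp add: field_simps)
      then have "exp ((ln (real (c n)) / real (l n) - \<mu>) * real (l n)) = real (c n) / exp \<mu> ^ l n"
        using False by (simp add: exp_diff exp_of_nat_mult)
      then show ?thesis using elim(1) by simp
    qed simp
  qed
qed

lemma filterlim_fib: "filterlim fib at_top sequentially"
proof (rule filterlim_at_top_mono)
  show "filterlim (\<lambda>n. n - 1) at_top sequentially"
    by (rule filterlim_minus_const_nat_at_top)
  show "eventually (\<lambda>n. n - 1 \<le> fib n) sequentially"
    using eventually_gt_at_top[of 0]
    by eventually_elim (metis Suc_diff_1 fib_ge)
qed

lemma tau_gt_1: "tau > 1"
  by (simp add: tau_def)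

lemma fib_ratio_tendsto: "(\<lambda>k. real (fib k) / real (fib (k + 3))) \<longlonglongrightarrow> 1 / tau ^ 3"
proof -
  have 1: "(\<lambda>k. real (fib k) / (tau ^ k / sqrt 5)) \<longlonglongrightarrow> 1"
    using fib_asymptotics by (simp add: tau_def)
  have "(\<lambda>k. (real (fib k) / (tau ^ k / sqrt 5)) / (real (fib (k + 3)) / (tau ^ (k + 3) / sqrt 5))
      * (1 / tau ^ 3)) \<longlonglongrightarrow> 1 / 1 * (1 / tau ^ 3)"
    by (intro tendsto_intros 1 LIMSEQ_ignore_initial_segment[OF 1]) simp
  moreover have "(x / (p / s)) / (y / (p * t / s)) * (1 / t) = x / y"
    if "p \<noteq> 0" "t \<noteq> 0" "s \<noteq> 0" for x y p t s :: real
    using that by (cases "y = 0") (simp_all add: field_simps)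
  ultimately show ?thesis
    using tau_gt_1 by (simp only: power_add) simp
qed

lemma double_at_top: "filterlim (\<lambda>n. 2 * n + k :: nat) at_top sequentially"
  by (rule filterlim_at_top_mono[OF filterlim_ident]) simp

text \<open>
  Common form of the two growth rates: \<open>d\<close> is the correction \<open>-1\<close> or \<open>+1\<close> in the exponent of the
  cardinality, and \<open>k\<close> selects odd or even indices.
\<close>

lemma fib_shift_ratio_tendsto:
  "(\<lambda>n. (real (fib (2 * n + k)) + d) * ln 2 / real (fib (2 * n + k + 3))) \<longlonglongrightarrow> 1 / tau ^ 3 * ln 2"
proof -
  have 1: "(\<lambda>n. real (fib (2 * n + k)) / real (fib (2 * n + k + 3))) \<longlonglongrightarrow> 1 / tau ^ 3"
    by (rule filterlim_compose[OF fib_ratio_tendsto double_at_top])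
  have 2: "(\<lambda>n. d / real (fib (2 * n + (k + 3)))) \<longlonglongrightarrow> 0"
    by (intro real_tendsto_divide_at_top[OF tendsto_const] filterlim_compose[OF filterlim_real_sequentially]
        filterlim_compose[OF filterlim_fib double_at_top])
  have "(\<lambda>n. (real (fib (2 * n + k)) / real (fib (2 * n + k + 3)) + d / real (fib (2 * n + (k + 3)))) * ln 2)
      \<longlonglongrightarrow> (1 / tau ^ 3 + 0) * ln 2"
    by (intro tendsto_intros 1 2)
  moreover have "(x / y + d / y) * z = (x + d) * z / y" for x y z :: real
    by (simp flip: add_divide_distrib)
  ultimately show ?thesis
    by (simp only: add.assoc add_0_right)
qed

section \<open>Entropy of the random Fibonacci chain\<close>

instance letter :: finite
proof
  have "(UNIV :: letter set) = {LA, LB}"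
    using letter.exhaust by auto
  then show "finite (UNIV :: letter set)"
    by (metis finite.emptyI finite.insertI)
qed

lemma inflA_growth: "(\<lambda>n. ln (real (card (inflA n))) / real (fib (2 * n))) \<longlonglongrightarrow> 1 / tau ^ 3 * ln 2"
proof (rule LIMSEQ_offset[of _ 2])
  have "ln (real (card (inflA (n + 2)))) / real (fib (2 * (n + 2)))
      = (real (fib (2 * n + 1)) + (- 1)) * ln 2 / real (fib (2 * n + 1 + 3))" for n
  proof -
    have "fib (2 * n + 1) \<ge> 1" using fib_neq_0_nat[of "2 * n + 1"] by simp
    moreover have "2 * (n + 2) = 2 * n + 1 + 3" by simp
    ultimately show ?thesis
      using card_infl[of n] by (simp only: of_nat_power ln_realpow of_nat_diff of_nat_numeral of_nat_1) simp
  qed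
  then show "(\<lambda>n. ln (real (card (inflA (n + 2)))) / real (fib (2 * (n + 2)))) \<longlonglongrightarrow> 1 / tau ^ 3 * ln 2"
    using fib_shift_ratio_tendsto[of 1 "- 1"] by presburger
qed

lemma inflB_growth: "(\<lambda>n. ln (real (card (inflB n))) / real (fib (2 * n - 1))) \<longlonglongrightarrow> 1 / tau ^ 3 * ln 2"
proof (rule LIMSEQ_offset[of _ 2])
  have "ln (real (card (inflB (n + 2)))) / real (fib (2 * (n + 2) - 1))
      = (real (fib (2 * n + 0)) + 1) * ln 2 / real (fib (2 * n + 0 + 3))" for n
  proof -
    have "2 * (n + 2) - 1 = 2 * n + 0 + 3" by simp
    then show ?thesis
      using card_infl[of n] by (simp only: of_nat_power ln_realpow of_nat_add of_nat_numeral of_nat_1) simp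
  qed
  then show "(\<lambda>n. ln (real (card (inflB (n + 2)))) / real (fib (2 * (n + 2) - 1))) \<longlonglongrightarrow> 1 / tau ^ 3 * ln 2"
    using fib_shift_ratio_tendsto[of 0 1] by presburger
qed

lemma fib_even_at_top: "filterlim (\<lambda>n. fib (2 * n)) at_top sequentially"
  using filterlim_compose[OF filterlim_fib double_at_top[of 0]] by simp

lemma fib_odd_at_top: "filterlim (\<lambda>n. fib (2 * n - 1)) at_top sequentially"
  by (rule filterlim_compose[OF filterlim_fib], rule filterlim_at_top_mono[OF filterlim_ident])
    (rule eventually_sequentiallyI[of 1], simp)

lemma factors_limB_lower:
  assumes "m > 0"
  shows "1 / tau ^ 3 * ln 2 \<le> ln (real (card (factors limB m))) / real m"
proof (rule ln_card_factors_ge[OF _ fib_odd_at_top inflB_growth assms])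
  have "inflB n \<noteq> {} \<and> inflB n \<subseteq> factors limB (fib (2 * n - 1))" if n: "n \<ge> 3" for n
  proof
    show "inflB n \<noteq> {}" using n by (intro inflB_ne) simp
    show "inflB n \<subseteq> factors limB (fib (2 * n - 1))"
    proof
      fix u assume "u \<in> inflB n"
      with n obtain w where w: "w \<in> limB" "stake (fib (2 * n - 1)) w = u"
        by (rule inflB_extends_to_limB)
      then have "u = stake (fib (2 * n - 1)) (sdrop 0 w)" by simp
      then show "u \<in> factors limB (fib (2 * n - 1))"
        unfolding factors_def using w(1) by blast
    qed
  qed
  then show "eventually (\<lambda>n. inflB n \<noteq> {} \<and> inflB n \<subseteq> factors limB (fib (2 * n - 1))) sequentially"
    by (rule eventually_sequentiallyI)
qed

lemma factors_limA_upper: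
  assumes "\<epsilon> > 0"
  shows "\<exists>c. \<forall>m. real (card (factors limA m)) \<le> c * exp (1 / tau ^ 3 * ln 2 + \<epsilon>) ^ m"
proof -
  define h where "h = 1 / tau ^ 3 * ln 2"
  define \<rho> where "\<rho> = exp (h + \<epsilon>)"
  have "h > 0" using tau_gt_1 by (simp add: h_def)
  then have \<rho>: "1 \<le> \<rho>" using assms by (simp add: \<rho>_def)
  have "h < h + \<epsilon>" using assms by simp
  from eventually_conj[OF eventually_ge_at_top[of 1] eventually_conj[OF
    weight_eventually_le_half[OF inflA_growth[folded h_def] fib_even_at_top this]
    weight_eventually_le_half[OF inflB_growth[folded h_def] fib_odd_at_top this]]]
  obtain n where n: "n \<ge> 1"
    and wA: "real (card (inflA n)) / \<rho> ^ fib (2 * n) \<le> 1 / 2"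
    and wB: "real (card (inflB n)) / \<rho> ^ fib (2 * n - 1) \<le> 1 / 2"
    unfolding \<rho>_def by (auto dest: eventually_happens)
  let ?g = "\<lambda>b :: letter list. 1 / \<rho> ^ length b"
  have "sum ?g (inflA n \<union> inflB n) \<le> sum ?g (inflA n) + sum ?g (inflB n)"
    using sum.union_inter[OF finite_inflA[of n] finite_inflB[of n], of ?g]
      sum_nonneg[of "inflA n \<inter> inflB n" ?g] \<rho> by simp
  also have "sum ?g (inflA n) = real (card (inflA n)) / \<rho> ^ fib (2 * n)"
    by (simp add: length_inflA)
  also have "sum ?g (inflB n) = real (card (inflB n)) / \<rho> ^ fib (2 * n - 1)"
    by (simp add: length_inflB)
  finally have kraft: "sum ?g (inflA n \<union> inflB n) \<le> 1" using wA wB by linarith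
  have ne: "[] \<notin> inflA n \<union> inflB n"
    using length_inflA[of "[]" n] length_inflB[of "[]" n] fib_neq_0_nat[of "2 * n"]
      fib_neq_0_nat[of "2 * n - 1"] n by auto
  have "\<exists>c. \<forall>m. real (card (factors limA m)) \<le> c * \<rho> ^ m"
    by (rule card_factors_le[OF _ ne \<rho> kraft limA_prefix_of_blocks[OF _ n]])
      (simp_all add: finite_inflA finite_inflB)
  then show ?thesis by (simp add: \<rho>_def h_def)
qed

theorem theorem2:
  fixes C :: "letter stream set"
  assumes "C \<in> {limA, limB}"
  shows "(\<lambda>n. ln (real (card (inflA n))) / real (fib (2 * n)))
           \<longlonglongrightarrow> 1 / tau ^ 3 * ln 2
       \<and> (\<lambda>n. ln (real (card (inflB n))) / real (fib (2 * n - 1)))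
           \<longlonglongrightarrow> 1 / tau ^ 3 * ln 2
       \<and> (\<lambda>n. ln (real (card (factors C n))) / real n)
           \<longlonglongrightarrow> 1 / tau ^ 3 * ln 2"
proof (intro conjI inflA_growth inflB_growth)
  have C: "limB \<subseteq> C" "C \<subseteq> limA"
    using assms limB_subset_limA by auto
  obtain u where "u \<in> inflB 3" using inflB_ne[of 3] by auto
  then have "limB \<noteq> {}" by (rule inflB_extends_to_limB[rotated]) auto
  then have posB: "card (factors limB m) > 0" for m
    using factors_ne finite_factors card_gt_0_iff by metis
  have le1: "card (factors limB m) \<le> card (factors C m)" for m
    by (intro card_mono finite_factors factors_mono C)
  have le2: "card (factors C m) \<le> card (factors limA m)" for m
    by (intro card_mono finite_factors factors_mono C)
  show "(\<lambda>n. ln (real (card (factors C n))) / real n) \<longlonglongrightarrow> 1 / tau ^ 3 * ln 2"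
  proof (rule ln_growth_tendsto)
    show pos: "card (factors C m) > 0" for m
      using posB[of m] le1[of m] by simp
    show "1 / tau ^ 3 * ln 2 \<le> ln (real (card (factors C m))) / real m" if "m > 0" for m
    proof -
      have "ln (real (card (factors limB m))) \<le> ln (real (card (factors C m)))"
        using posB[of m] pos[of m] le1[of m] by (subst ln_le_cancel_iff) auto
      then have "ln (real (card (factors limB m))) / real m \<le> ln (real (card (factors C m))) / real m"
        by (rule divide_right_mono) simp
      then show ?thesis using factors_limB_lower[OF that] by linarith
    qed
    show "\<exists>c. \<forall>m. real (card (factors C m)) \<le> c * exp (1 / tau ^ 3 * ln 2 + \<epsilon>) ^ m" if "\<epsilon> > 0" for \<epsilon>
      using factors_limA_upper[OF that] le2 by (meson of_nat_le_iff order_trans)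
  qed
qed

end
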